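(* Let $a,\tilde a,\alpha\in\mathbb{R}$ be such that $a\sim\tilde a\,;\,\mathrm{rp}(\alpha)$. If $k\in\mathbb{R}$, then $$|a|^{k}\sim|\tilde a|^{k}\,;\,\mathrm{rp}(|k|\alpha).$$
   Context: For $a,\tilde a,\alpha\in\mathbb{R}$, the notation $a\sim\tilde a\,;\,\mathrm{rp}(\alpha)$ ("$\tilde a$ is an approximation to $a$ of relative precision $\alpha$") means: $\alpha\ge 0$, $a$ and $\tilde a$ are nonzero and have the same sign, and $|\ln(\tilde a/a)|\le\alpha$. Powers $|a|^k$ are real powers of positive real numbers. *)

theory Defs
  imports Complex_Main
begin

definition rp_approx :: "real \<Rightarrow> real \<Rightarrow> real \<Rightarrow> bool"
    ("(_ \<sim> _ ; rp'(_'))" [51, 51, 0] 50) where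
  "a \<sim> a' ; rp(\<alpha>) \<longleftrightarrow>
     \<alpha> \<ge> 0 \<and> a \<noteq> 0 \<and> a' \<noteq> 0 \<and> sgn a = sgn a' \<and> \<bar>ln (a' / a)\<bar> \<le> \<alpha>"

end

theory Submission
  imports Defs
begin

text \<open>
  Since \<open>a\<close> and \<open>a'\<close> have the same sign, \<open>a' / a = \<bar>a'\<bar> / \<bar>a\<bar>\<close>; hence raising the absolute
  values to the power \<open>k\<close> multiplies the logarithm of the quotient by \<open>k\<close>, and the bound
  on its absolute value by \<open>\<bar>k\<bar>\<close>.
\<close>

theorem mainTheorem4:
  fixes a a' \<alpha> k :: real
  assumes "a \<sim> a' ; rp(\<alpha>)"
  shows "\<bar>a\<bar> powr k \<sim> \<bar>a'\<bar> powr k ; rp(\<bar>k\<bar> * \<alpha>)"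
proof -
  have \<alpha>: "\<alpha> \<ge> 0" and a: "a \<noteq> 0" "a' \<noteq> 0" and sgn: "sgn a = sgn a'"
    and bound: "\<bar>ln (a' / a)\<bar> \<le> \<alpha>"
    using assms by (auto simp: rp_approx_def)
  have quot: "a' / a = \<bar>a'\<bar> / \<bar>a\<bar>"
    using a sgn by (auto simp: sgn_if abs_if split: if_splits)
  have "ln (\<bar>a'\<bar> powr k / \<bar>a\<bar> powr k) = k * ln (a' / a)"
    using a by (simp add: quot ln_div ln_powr right_diff_distrib)
  then have "\<bar>ln (\<bar>a'\<bar> powr k / \<bar>a\<bar> powr k)\<bar> \<le> \<bar>k\<bar> * \<alpha>"
    using bound by (simp add: abs_mult mult_left_mono)
  then show ?thesis
    using \<alpha> a by (simp add: rp_approx_def)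
qed

end
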